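(* Let $M_h$ be a model of a high-level BAT $\mathcal{D}_h$ and $M_l$ a model of $\mathcal{D}_l\cup\mathcal{C}$ for a low-level BAT $\mathcal{D}_l$, let $m$ be a refinement mapping from $\mathcal{D}_h$ to $\mathcal{D}_l$, and suppose $M_h\sim_m M_l$. Then for any sequence of ground high-level actions $\vec\alpha$ and any high-level situation-suppressed formula $\phi$: $M_l\models\exists s'.\,Do(m(\vec\alpha),S_0,s')\land m(\phi)[s']$ if and only if $M_h\models Executable(do(\vec\alpha,S_0))\land\phi[do(\vec\alpha,S_0)]$.
   Context: Situation calculus setting. Objects are a countably infinite set $\mathcal{N}$ of standard names (unique names and domain closure); no function symbols other than constants; no non-fluent predicates. Situations: $S_0$ and $do(a,s)$; $do([a_1,\dots,a_n],s)$ abbreviates $do(a_n,\dots,do(a_1,s)\dots)$, also written $do(\vec a,s)$. $Poss(a,s)$ means $a$ is executable in $s$; $Executable(s)$ means every action along the history from $S_0$ to $s$ was possible where performed. A basic action theory (BAT) over finitely many action types $\mathcal{A}$ and fluents $\mathcal{F}$ consists of initial-state axioms $\mathcal{D}_{S_0}$, precondition axioms $Poss(A(\vec x),s)\equiv\phi^{Poss}_A(\vec x,s)$, successor state axioms $F(\vec x,do(a,s))\equiv\phi^{ssa}_F(\vec x,a,s)$ (right-hand sides uniform in $s$), unique names/domain closure axioms for actions $\mathcal{D}_{ca}$ and for objects $\mathcal{D}_{coa}$, and foundational axioms $\Sigma$. A situation-suppressed formula omits situation arguments of fluents; $\phi[s]$ restores $s$. ConGolog programs $\delta::=\alpha\mid\varphi?\mid\delta_1;\delta_2\mid\delta_1|\delta_2\mid\pi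 x.\delta\mid\delta^*\mid\delta_1\|\delta_2$, $nil=True?$; $\mathcal{C}$ are the axioms: $Trans(\alpha,s,\delta',s')\equiv s'=do(\alpha,s)\land Poss(\alpha,s)\land\delta'=True?$; $Trans(\varphi?,s,\delta',s')\equiv False$; $Trans(\delta_1;\delta_2,s,\delta',s')\equiv\exists\delta_1'(Trans(\delta_1,s,\delta_1',s')\land\delta'=\delta_1';\delta_2)\lor(Final(\delta_1,s)\land Trans(\delta_2,s,\delta',s'))$; $Trans(\delta_1|\delta_2,\cdot)\equiv Trans(\delta_1,\cdot)\lor Trans(\delta_2,\cdot)$; $Trans(\pi x.\delta,s,\delta',s')\equiv\exists x.Trans(\delta,s,\delta',s')$; $Trans(\delta^*,s,\delta',s')\equiv\exists\delta''(Trans(\delta,s,\delta'',s')\land\delta'=\delta'';\delta^* )$; $Trans(\delta_1\|\delta_2,s,\delta',s')\equiv\exists\delta_1'(Trans(\delta_1,s,\delta_1',s')\land\delta'=\delta_1'\|\delta_2)\lor\exists\delta_2'(Trans(\delta_2,s,\delta_2',s')\land\delta'=\delta_1\|\delta_2')$; $Final(\alpha,s)\equiv False$; $Final(\varphi?,s)\equiv\varphi[s]$; $Final(\delta_1;\delta_2,s)\equiv Final(\delta_1,s)\land Final(\delta_2,s)$; $Final(\delta_1|\delta_2,s)\equiv Final(\delta_1,s)\lor Final(\delta_2,s)$; $Final(\pi x.\delta,s)\equiv\exists x.Final(\delta,s)$; $Final(\delta^*,s)\equiv True$; $Final(\delta_1\|\delta_2,s)\equiv Final(\delta_1,s)\land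 Final(\delta_2,s)$. $Do(\delta,s,s')\doteq\exists\delta'.Trans^*(\delta,s,\delta',s')\land Final(\delta',s')$, $Trans^*$ the reflexive transitive closure. $\mathcal{D}_h$, $\mathcal{D}_l$ have action types $\mathcal{A}_h,\mathcal{A}_l$ and fluents $\mathcal{F}_h,\mathcal{F}_l$, sharing only $\mathcal{N}$. A refinement mapping $m$ maps each $A\in\mathcal{A}_h$ to a situation-determined ConGolog program $m(A(\vec x))$ over $\mathcal{D}_l$ with free variables $\vec x$ (situation-determined: the remaining program after any sequence of transitions is determined by the resulting situation), and each $F\in\mathcal{F}_h$ to a situation-suppressed low-level formula $m(F(\vec x))$; $m(\phi)$ substitutes $m(F(\vec x))$ for fluent atoms in $\phi$; $m(\alpha_1,\dots,\alpha_n)=m(\alpha_1);\dots;m(\alpha_n)$, $m(\epsilon)=nil$. $s_h\simeq_m^{M_h,M_l}s_l$ ($m$-isomorphic) iff for all $F\in\mathcal{F}_h$ and assignments $v$, $M_h,v[s/s_h]\models F(\vec x,s)$ iff $M_l,v[s/s_l]\models m(F(\vec x))[s]$. A relation $B$ between situation domains of $M_h$ and $M_l$ is an $m$-bisimulation if each $\langle s_h,s_l\rangle\in B$ satisfies: (1) $s_h\simeq_m^{M_h,M_l}s_l$; (2) for each $A\in\mathcal{A}_h$ and $v$, if some $s_h'$ has $M_h,v[s/s_h,s'/s_h']\models Poss(A(\vec x),s)\land s'=do(A(\vec x),s)$ then some $s_l'$ has $M_l,v[s/s_l,s'/s_l']\models Do(m(A(\vec x)),s,s')$ and $\langle s_h',s_l'\rangle\in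 B$; (3) for each $A\in\mathcal{A}_h$ and $v$, if some $s_l'$ has $M_l,v[s/s_l,s'/s_l']\models Do(m(A(\vec x)),s,s')$ then some $s_h'$ has $M_h,v[s/s_h,s'/s_h']\models Poss(A(\vec x),s)\land s'=do(A(\vec x),s)$ and $\langle s_h',s_l'\rangle\in B$. $M_h\sim_m M_l$ iff some $m$-bisimulation contains $\langle S_0^{M_h},S_0^{M_l}\rangle$. *)

theory Defs
  imports Main "HOL-Library.Countable" "HOL-Library.Infinite_Typeclass"
begin

text \<open>
  Type variable conventions: \<open>'n\<close> standard names, \<open>'f\<close> fluent symbols, \<open>'a\<close> action types, \<open>'d\<close> and \<open>'s\<close> the
  action and situation domains of a structure. Unique names and domain closure for objects make the
  object domain the set of standard names itself, so object assignments are maps into \<open>'n\<close>, shared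
  by all structures. Bound variables are de Bruijn indices. In a formula or program schema with
  parameters \<open>x\<^sub>0, \<dots>, x\<^sub>k\<^sub>-\<^sub>1\<close>, the parameter \<open>x\<^sub>i\<close> is the free index \<open>i\<close>.
\<close>

record ('f, 'a) signat =
  farity :: "'f \<Rightarrow> nat"
  aarity :: "'a \<Rightarrow> nat"

datatype 'n tm = Var nat | Cst 'n

primrec eval_tm :: "(nat \<Rightarrow> 'n) \<Rightarrow> 'n tm \<Rightarrow> 'n" where
  "eval_tm v (Var i) = v i"
| "eval_tm v (Cst n) = n"

primrec wf_tm :: "nat \<Rightarrow> 'n tm \<Rightarrow> bool" where
  "wf_tm k (Var i) \<longleftrightarrow> i < k"
| "wf_tm k (Cst n) \<longleftrightarrow> True"

definition xvars :: "nat \<Rightarrow> 'n tm list" where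
  "xvars k = map Var [0..<k]"

subsection \<open>Structures and foundational axioms\<close>

record ('n, 'f, 'a, 'd, 's) sc_struct =
  act :: "'a \<Rightarrow> 'n list \<Rightarrow> 'd"
  S0 :: 's
  do_act :: "'d \<Rightarrow> 's \<Rightarrow> 's"
  before :: "'s \<Rightarrow> 's \<Rightarrow> bool"
  Poss :: "'d \<Rightarrow> 's \<Rightarrow> bool"
  fluent :: "'f \<Rightarrow> 'n list \<Rightarrow> 's \<Rightarrow> bool"

definition before_eq :: "('n, 'f, 'a, 'd, 's, 'z) sc_struct_scheme \<Rightarrow> 's \<Rightarrow> 's \<Rightarrow> bool" where
  "before_eq M s s' \<longleftrightarrow> before M s s' \<or> s = s'"

definition foundational :: "('n, 'f, 'a, 'd, 's, 'z) sc_struct_scheme \<Rightarrow> bool" where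
  "foundational M \<longleftrightarrow>
     (\<forall>d d' s s'. do_act M d s = do_act M d' s' \<longrightarrow> d = d' \<and> s = s') \<and>
     (\<forall>P. P (S0 M) \<and> (\<forall>d s. P s \<longrightarrow> P (do_act M d s)) \<longrightarrow> (\<forall>s. P s)) \<and>
     (\<forall>s. \<not> before M s (S0 M)) \<and>
     (\<forall>d s s'. before M s (do_act M d s') \<longleftrightarrow> before_eq M s s')"

definition action_axioms ::
  "('f, 'a) signat \<Rightarrow> ('n, 'f, 'a, 'd, 's, 'z) sc_struct_scheme \<Rightarrow> bool" where
  "action_axioms sg M \<longleftrightarrow>
     (\<forall>A B ms ns. length ms = aarity sg A \<and> length ns = aarity sg B \<and> act M A ms = act M B ns
        \<longrightarrow> A = B \<and> ms = ns) \<and>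
     (\<forall>d. \<exists>A ns. length ns = aarity sg A \<and> d = act M A ns)"

definition Executable :: "('n, 'f, 'a, 'd, 's, 'z) sc_struct_scheme \<Rightarrow> 's \<Rightarrow> bool" where
  "Executable M s \<longleftrightarrow> (\<forall>d s'. before_eq M (do_act M d s') s \<longrightarrow> Poss M d s')"

definition do_seq ::
  "('n, 'f, 'a, 'd, 's, 'z) sc_struct_scheme \<Rightarrow> ('a \<times> 'n list) list \<Rightarrow> 's \<Rightarrow> 's" where
  "do_seq M as s = foldl (\<lambda>s (A, ns). do_act M (act M A ns) s) s as"

subsection \<open>Uniform formulas and basic action theories\<close>

text \<open>
  Right-hand sides of axioms, uniform in one situation that is left implicit. There are separate
  index spaces for object variables (bound by \<open>UEx\<close>) and action variables (bound by \<open>UExA\<close>).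
\<close>

datatype ('n, 'a) atm = AVar nat | AApp 'a "'n tm list"

datatype ('n, 'f, 'a) uform =
    UFlu 'f "'n tm list"
  | UEq "'n tm" "'n tm"
  | UActEq "('n, 'a) atm" "('n, 'a) atm"
  | UTrue
  | UNeg "('n, 'f, 'a) uform"
  | UConj "('n, 'f, 'a) uform" "('n, 'f, 'a) uform"
  | UEx "('n, 'f, 'a) uform"
  | UExA "('n, 'f, 'a) uform"

primrec eval_atm ::
  "('n, 'f, 'a, 'd, 's, 'z) sc_struct_scheme \<Rightarrow> (nat \<Rightarrow> 'n) \<Rightarrow> (nat \<Rightarrow> 'd) \<Rightarrow> ('n, 'a) atm \<Rightarrow> 'd" where
  "eval_atm M v w (AVar i) = w i"
| "eval_atm M v w (AApp A ts) = act M A (map (eval_tm v) ts)"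

primrec usat ::
  "('n, 'f, 'a, 'd, 's, 'z) sc_struct_scheme \<Rightarrow> (nat \<Rightarrow> 'n) \<Rightarrow> (nat \<Rightarrow> 'd) \<Rightarrow> 's
     \<Rightarrow> ('n, 'f, 'a) uform \<Rightarrow> bool" where
  "usat M v w s (UFlu F ts) \<longleftrightarrow> fluent M F (map (eval_tm v) ts) s"
| "usat M v w s (UEq t u) \<longleftrightarrow> eval_tm v t = eval_tm v u"
| "usat M v w s (UActEq a b) \<longleftrightarrow> eval_atm M v w a = eval_atm M v w b"
| "usat M v w s UTrue \<longleftrightarrow> True"
| "usat M v w s (UNeg \<phi>) \<longleftrightarrow> \<not> usat M v w s \<phi>"
| "usat M v w s (UConj \<phi> \<psi>) \<longleftrightarrow> usat M v w s \<phi> \<and> usat M v w s \<psi>"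
| "usat M v w s (UEx \<phi>) \<longleftrightarrow> (\<exists>n. usat M (case_nat n v) w s \<phi>)"
| "usat M v w s (UExA \<phi>) \<longleftrightarrow> (\<exists>d. usat M v (case_nat d w) s \<phi>)"

primrec wf_atm :: "('f, 'a) signat \<Rightarrow> nat \<Rightarrow> nat \<Rightarrow> ('n, 'a) atm \<Rightarrow> bool" where
  "wf_atm sg k j (AVar i) \<longleftrightarrow> i < j"
| "wf_atm sg k j (AApp A ts) \<longleftrightarrow> length ts = aarity sg A \<and> (\<forall>t \<in> set ts. wf_tm k t)"

text \<open>\<open>wf_uform sg k j \<phi>\<close>: arities are respected, free object indices are below \<open>k\<close> and free action
  indices below \<open>j\<close>. The predicates \<open>wf_fm\<close> and \<open>wf_prog\<close> below follow the same pattern.\<close>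

primrec wf_uform :: "('f, 'a) signat \<Rightarrow> nat \<Rightarrow> nat \<Rightarrow> ('n, 'f, 'a) uform \<Rightarrow> bool" where
  "wf_uform sg k j (UFlu F ts) \<longleftrightarrow> length ts = farity sg F \<and> (\<forall>t \<in> set ts. wf_tm k t)"
| "wf_uform sg k j (UEq t u) \<longleftrightarrow> wf_tm k t \<and> wf_tm k u"
| "wf_uform sg k j (UActEq a b) \<longleftrightarrow> wf_atm sg k j a \<and> wf_atm sg k j b"
| "wf_uform sg k j UTrue \<longleftrightarrow> True"
| "wf_uform sg k j (UNeg \<phi>) \<longleftrightarrow> wf_uform sg k j \<phi>"
| "wf_uform sg k j (UConj \<phi> \<psi>) \<longleftrightarrow> wf_uform sg k j \<phi> \<and> wf_uform sg k j \<psi>"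
| "wf_uform sg k j (UEx \<phi>) \<longleftrightarrow> wf_uform sg (Suc k) j \<phi>"
| "wf_uform sg k j (UExA \<phi>) \<longleftrightarrow> wf_uform sg k (Suc j) \<phi>"

record ('n, 'f, 'a) bat =
  sig :: "('f, 'a) signat"
  init :: "('n, 'f, 'a) uform set"
  pre :: "'a \<Rightarrow> ('n, 'f, 'a) uform"
  ssa :: "'f \<Rightarrow> ('n, 'f, 'a) uform"

text \<open>The action argument of a successor state axiom is the free action index \<open>0\<close>.\<close>

definition is_bat :: "('n::{countable, infinite}, 'f::finite, 'a::finite) bat \<Rightarrow> bool" where
  "is_bat D \<longleftrightarrow>
     (\<forall>\<phi> \<in> init D. wf_uform (sig D) 0 0 \<phi>) \<and>
     (\<forall>A. wf_uform (sig D) (aarity (sig D) A) 0 (pre D A)) \<and>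
     (\<forall>F. wf_uform (sig D) (farity (sig D) F) 1 (ssa D F))"

definition models_bat ::
  "('n, 'f, 'a, 'd, 's, 'z) sc_struct_scheme \<Rightarrow> ('n, 'f, 'a) bat \<Rightarrow> bool" where
  "models_bat M D \<longleftrightarrow>
     foundational M \<and> action_axioms (sig D) M \<and>
     (\<forall>\<phi> \<in> init D. \<forall>v w. usat M v w (S0 M) \<phi>) \<and>
     (\<forall>A v w s. Poss M (eval_atm M v w (AApp A (xvars (aarity (sig D) A)))) s
        \<longleftrightarrow> usat M v w s (pre D A)) \<and>
     (\<forall>F v w s. usat M v w (do_act M (w 0) s) (UFlu F (xvars (farity (sig D) F)))
        \<longleftrightarrow> usat M v w s (ssa D F))"

subsection \<open>Situation-suppressed formulas\<close>

datatype ('n, 'f) fm =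
    Flu 'f "'n tm list"
  | Eq "'n tm" "'n tm"
  | TrueF
  | Neg "('n, 'f) fm"
  | Conj "('n, 'f) fm" "('n, 'f) fm"
  | Exists "('n, 'f) fm"

text \<open>\<open>sat M v s \<phi>\<close> is \<open>M, v \<Turnstile> \<phi>[s]\<close>.\<close>

primrec sat ::
  "('n, 'f, 'a, 'd, 's, 'z) sc_struct_scheme \<Rightarrow> (nat \<Rightarrow> 'n) \<Rightarrow> 's \<Rightarrow> ('n, 'f) fm \<Rightarrow> bool" where
  "sat M v s (Flu F ts) \<longleftrightarrow> fluent M F (map (eval_tm v) ts) s"
| "sat M v s (Eq t u) \<longleftrightarrow> eval_tm v t = eval_tm v u"
| "sat M v s TrueF \<longleftrightarrow> True"
| "sat M v s (Neg \<phi>) \<longleftrightarrow> \<not> sat M v s \<phi>"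
| "sat M v s (Conj \<phi> \<psi>) \<longleftrightarrow> sat M v s \<phi> \<and> sat M v s \<psi>"
| "sat M v s (Exists \<phi>) \<longleftrightarrow> (\<exists>n. sat M (case_nat n v) s \<phi>)"

primrec wf_fm :: "('f, 'a) signat \<Rightarrow> nat \<Rightarrow> ('n, 'f) fm \<Rightarrow> bool" where
  "wf_fm sg k (Flu F ts) \<longleftrightarrow> length ts = farity sg F \<and> (\<forall>t \<in> set ts. wf_tm k t)"
| "wf_fm sg k (Eq t u) \<longleftrightarrow> wf_tm k t \<and> wf_tm k u"
| "wf_fm sg k TrueF \<longleftrightarrow> True"
| "wf_fm sg k (Neg \<phi>) \<longleftrightarrow> wf_fm sg k \<phi>"
| "wf_fm sg k (Conj \<phi> \<psi>) \<longleftrightarrow> wf_fm sg k \<phi> \<and> wf_fm sg k \<psi>"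
| "wf_fm sg k (Exists \<phi>) \<longleftrightarrow> wf_fm sg (Suc k) \<phi>"

primrec subst_tm :: "(nat \<Rightarrow> 'n tm) \<Rightarrow> 'n tm \<Rightarrow> 'n tm" where
  "subst_tm \<sigma> (Var i) = \<sigma> i"
| "subst_tm \<sigma> (Cst n) = Cst n"

definition up :: "(nat \<Rightarrow> 'n tm) \<Rightarrow> nat \<Rightarrow> 'n tm" where
  "up \<sigma> = case_nat (Var 0) (\<lambda>i. subst_tm (\<lambda>j. Var (Suc j)) (\<sigma> i))"

primrec subst_fm :: "(nat \<Rightarrow> 'n tm) \<Rightarrow> ('n, 'f) fm \<Rightarrow> ('n, 'f) fm" where
  "subst_fm \<sigma> (Flu F ts) = Flu F (map (subst_tm \<sigma>) ts)"
| "subst_fm \<sigma> (Eq t u) = Eq (subst_tm \<sigma> t) (subst_tm \<sigma> u)"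
| "subst_fm \<sigma> TrueF = TrueF"
| "subst_fm \<sigma> (Neg \<phi>) = Neg (subst_fm \<sigma> \<phi>)"
| "subst_fm \<sigma> (Conj \<phi> \<psi>) = Conj (subst_fm \<sigma> \<phi>) (subst_fm \<sigma> \<psi>)"
| "subst_fm \<sigma> (Exists \<phi>) = Exists (subst_fm (up \<sigma>) \<phi>)"

text \<open>Substitution of \<open>ts\<close> for the parameters; the default value is never reached when the schema has
  at most \<open>length ts\<close> parameters.\<close>

definition params :: "'n tm list \<Rightarrow> nat \<Rightarrow> 'n tm" where
  "params ts i = (if i < length ts then ts ! i else Var i)"

subsection \<open>ConGolog\<close>

datatype ('n, 'f, 'a) prog =
    Act 'a "'n tm list"
  | Test "('n, 'f) fm"
  | Seq "('n, 'f, 'a) prog" "('n, 'f, 'a) prog"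
  | Choice "('n, 'f, 'a) prog" "('n, 'f, 'a) prog"
  | Pick "('n, 'f, 'a) prog"
  | Star "('n, 'f, 'a) prog"
  | Conc "('n, 'f, 'a) prog" "('n, 'f, 'a) prog"

definition nil :: "('n, 'f, 'a) prog" where
  "nil = Test TrueF"

primrec wf_prog :: "('f, 'a) signat \<Rightarrow> nat \<Rightarrow> ('n, 'f, 'a) prog \<Rightarrow> bool" where
  "wf_prog sg k (Act A ts) \<longleftrightarrow> length ts = aarity sg A \<and> (\<forall>t \<in> set ts. wf_tm k t)"
| "wf_prog sg k (Test \<phi>) \<longleftrightarrow> wf_fm sg k \<phi>"
| "wf_prog sg k (Seq \<delta>1 \<delta>2) \<longleftrightarrow> wf_prog sg k \<delta>1 \<and> wf_prog sg k \<delta>2"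
| "wf_prog sg k (Choice \<delta>1 \<delta>2) \<longleftrightarrow> wf_prog sg k \<delta>1 \<and> wf_prog sg k \<delta>2"
| "wf_prog sg k (Pick \<delta>) \<longleftrightarrow> wf_prog sg (Suc k) \<delta>"
| "wf_prog sg k (Star \<delta>) \<longleftrightarrow> wf_prog sg k \<delta>"
| "wf_prog sg k (Conc \<delta>1 \<delta>2) \<longleftrightarrow> wf_prog sg k \<delta>1 \<and> wf_prog sg k \<delta>2"

primrec subst_prog :: "(nat \<Rightarrow> 'n tm) \<Rightarrow> ('n, 'f, 'a) prog \<Rightarrow> ('n, 'f, 'a) prog" where
  "subst_prog \<sigma> (Act A ts) = Act A (map (subst_tm \<sigma>) ts)"
| "subst_prog \<sigma> (Test \<phi>) = Test (subst_fm \<sigma> \<phi>)"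
| "subst_prog \<sigma> (Seq \<delta>1 \<delta>2) = Seq (subst_prog \<sigma> \<delta>1) (subst_prog \<sigma> \<delta>2)"
| "subst_prog \<sigma> (Choice \<delta>1 \<delta>2) = Choice (subst_prog \<sigma> \<delta>1) (subst_prog \<sigma> \<delta>2)"
| "subst_prog \<sigma> (Pick \<delta>) = Pick (subst_prog (up \<sigma>) \<delta>)"
| "subst_prog \<sigma> (Star \<delta>) = Star (subst_prog \<sigma> \<delta>)"
| "subst_prog \<sigma> (Conc \<delta>1 \<delta>2) = Conc (subst_prog \<sigma> \<delta>1) (subst_prog \<sigma> \<delta>2)"

definition bind_name :: "'n \<Rightarrow> ('n, 'f, 'a) prog \<Rightarrow> ('n, 'f, 'a) prog" where
  "bind_name n \<delta> = subst_prog (case_nat (Cst n) Var) \<delta>"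

record ('n, 'f, 'a, 'd, 's) cg_struct = "('n, 'f, 'a, 'd, 's) sc_struct" +
  Trans :: "('n, 'f, 'a) prog \<Rightarrow> 's \<Rightarrow> ('n, 'f, 'a) prog \<Rightarrow> 's \<Rightarrow> bool"
  Final :: "('n, 'f, 'a) prog \<Rightarrow> 's \<Rightarrow> bool"

text \<open>
  The program sort consists of the closed well-formed programs. Every object is denoted by a standard
  name, so the quantifier in the axioms for \<open>\<pi>x.\<delta>\<close> ranges over the instances \<open>\<delta>[n/x]\<close>.
\<close>

definition congolog ::
  "('f, 'a) signat \<Rightarrow> ('n, 'f, 'a, 'd, 's, 'z) cg_struct_scheme \<Rightarrow> bool" where
  "congolog sg M \<longleftrightarrow>
     (\<forall>A ns s \<delta>' s'. wf_prog sg 0 (Act A (map Cst ns)) \<longrightarrow>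
        (Trans M (Act A (map Cst ns)) s \<delta>' s' \<longleftrightarrow>
           s' = do_act M (act M A ns) s \<and> Poss M (act M A ns) s \<and> \<delta>' = nil)) \<and>
     (\<forall>\<phi> s \<delta>' s'. wf_prog sg 0 (Test \<phi>) \<longrightarrow> (Trans M (Test \<phi>) s \<delta>' s' \<longleftrightarrow> False)) \<and>
     (\<forall>\<delta>1 \<delta>2 s \<delta>' s'. wf_prog sg 0 (Seq \<delta>1 \<delta>2) \<longrightarrow>
        (Trans M (Seq \<delta>1 \<delta>2) s \<delta>' s' \<longleftrightarrow>
           (\<exists>\<delta>1'. Trans M \<delta>1 s \<delta>1' s' \<and> \<delta>' = Seq \<delta>1' \<delta>2) \<or>
           (Final M \<delta>1 s \<and> Trans M \<delta>2 s \<delta>' s'))) \<and>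
     (\<forall>\<delta>1 \<delta>2 s \<delta>' s'. wf_prog sg 0 (Choice \<delta>1 \<delta>2) \<longrightarrow>
        (Trans M (Choice \<delta>1 \<delta>2) s \<delta>' s' \<longleftrightarrow> Trans M \<delta>1 s \<delta>' s' \<or> Trans M \<delta>2 s \<delta>' s')) \<and>
     (\<forall>\<delta> s \<delta>' s'. wf_prog sg 0 (Pick \<delta>) \<longrightarrow>
        (Trans M (Pick \<delta>) s \<delta>' s' \<longleftrightarrow> (\<exists>n. Trans M (bind_name n \<delta>) s \<delta>' s'))) \<and>
     (\<forall>\<delta> s \<delta>' s'. wf_prog sg 0 (Star \<delta>) \<longrightarrow>
        (Trans M (Star \<delta>) s \<delta>' s' \<longleftrightarrow>
           (\<exists>\<delta>''. Trans M \<delta> s \<delta>'' s' \<and> \<delta>' = Seq \<delta>'' (Star \<delta>)))) \<and>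
     (\<forall>\<delta>1 \<delta>2 s \<delta>' s'. wf_prog sg 0 (Conc \<delta>1 \<delta>2) \<longrightarrow>
        (Trans M (Conc \<delta>1 \<delta>2) s \<delta>' s' \<longleftrightarrow>
           (\<exists>\<delta>1'. Trans M \<delta>1 s \<delta>1' s' \<and> \<delta>' = Conc \<delta>1' \<delta>2) \<or>
           (\<exists>\<delta>2'. Trans M \<delta>2 s \<delta>2' s' \<and> \<delta>' = Conc \<delta>1 \<delta>2'))) \<and>
     (\<forall>A ns s. wf_prog sg 0 (Act A (map Cst ns)) \<longrightarrow>
        (Final M (Act A (map Cst ns)) s \<longleftrightarrow> False)) \<and>
     (\<forall>\<phi> s v. wf_prog sg 0 (Test \<phi>) \<longrightarrow> (Final M (Test \<phi>) s \<longleftrightarrow> sat M v s \<phi>)) \<and>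
     (\<forall>\<delta>1 \<delta>2 s. wf_prog sg 0 (Seq \<delta>1 \<delta>2) \<longrightarrow>
        (Final M (Seq \<delta>1 \<delta>2) s \<longleftrightarrow> Final M \<delta>1 s \<and> Final M \<delta>2 s)) \<and>
     (\<forall>\<delta>1 \<delta>2 s. wf_prog sg 0 (Choice \<delta>1 \<delta>2) \<longrightarrow>
        (Final M (Choice \<delta>1 \<delta>2) s \<longleftrightarrow> Final M \<delta>1 s \<or> Final M \<delta>2 s)) \<and>
     (\<forall>\<delta> s. wf_prog sg 0 (Pick \<delta>) \<longrightarrow>
        (Final M (Pick \<delta>) s \<longleftrightarrow> (\<exists>n. Final M (bind_name n \<delta>) s))) \<and>
     (\<forall>\<delta> s. wf_prog sg 0 (Star \<delta>) \<longrightarrow> (Final M (Star \<delta>) s \<longleftrightarrow> True)) \<and>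
     (\<forall>\<delta>1 \<delta>2 s. wf_prog sg 0 (Conc \<delta>1 \<delta>2) \<longrightarrow>
        (Final M (Conc \<delta>1 \<delta>2) s \<longleftrightarrow> Final M \<delta>1 s \<and> Final M \<delta>2 s))"

definition TransStar ::
  "('n, 'f, 'a, 'd, 's, 'z) cg_struct_scheme
     \<Rightarrow> ('n, 'f, 'a) prog \<Rightarrow> 's \<Rightarrow> ('n, 'f, 'a) prog \<Rightarrow> 's \<Rightarrow> bool" where
  "TransStar M \<delta> s \<delta>' s' \<longleftrightarrow> (\<lambda>(\<delta>, s) (\<delta>', s'). Trans M \<delta> s \<delta>' s')\<^sup>*\<^sup>* (\<delta>, s) (\<delta>', s')"

definition Do ::
  "('n, 'f, 'a, 'd, 's, 'z) cg_struct_scheme \<Rightarrow> ('n, 'f, 'a) prog \<Rightarrow> 's \<Rightarrow> 's \<Rightarrow> bool" where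
  "Do M \<delta> s s' \<longleftrightarrow> (\<exists>\<delta>'. TransStar M \<delta> s \<delta>' s' \<and> Final M \<delta>' s')"

definition situation_determined ::
  "('n, 'f, 'a, 'd, 's, 'z) cg_struct_scheme \<Rightarrow> ('n, 'f, 'a) prog \<Rightarrow> 's \<Rightarrow> bool" where
  "situation_determined M \<delta> s \<longleftrightarrow>
     (\<forall>s' \<delta>' \<delta>''. TransStar M \<delta> s \<delta>' s' \<and> TransStar M \<delta> s \<delta>'' s' \<longrightarrow> \<delta>' = \<delta>'')"

text \<open>\<open>close_prog v \<delta>\<close> is the denotation of the schema \<open>\<delta>\<close> in the program sort under the assignment
  \<open>v\<close>.\<close>

definition close_prog :: "(nat \<Rightarrow> 'n) \<Rightarrow> ('n, 'f, 'a) prog \<Rightarrow> ('n, 'f, 'a) prog" where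
  "close_prog v \<delta> = subst_prog (\<lambda>i. Cst (v i)) \<delta>"

subsection \<open>Refinement mappings\<close>

record ('n, 'fh, 'ah, 'fl, 'al) refmap =
  map_action :: "'ah \<Rightarrow> ('n, 'fl, 'al) prog"
  map_fluent :: "'fh \<Rightarrow> ('n, 'fl) fm"

text \<open>
  Being situation-determined is required in all situations of all models of the low-level theory
  together with the ConGolog axioms. HOL cannot quantify over the domain types of these models, so
  they are passed as a parameter. This loses nothing: by the foundational and the action axioms, any
  two models of one theory have isomorphic action and situation domains.
\<close>

definition refinement_mapping ::
  "('d \<times> 's) itself \<Rightarrow> ('n, 'fh, 'ah) bat \<Rightarrow> ('n, 'fl, 'al) bat
     \<Rightarrow> ('n, 'fh, 'ah, 'fl, 'al) refmap \<Rightarrow> bool" where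
  "refinement_mapping ty Dh Dl m \<longleftrightarrow>
     (\<forall>A. wf_prog (sig Dl) (aarity (sig Dh) A) (map_action m A)) \<and>
     (\<forall>M :: ('n, 'fl, 'al, 'd, 's) cg_struct. models_bat M Dl \<and> congolog (sig Dl) M \<longrightarrow>
        (\<forall>A v s. situation_determined M (close_prog v (map_action m A)) s)) \<and>
     (\<forall>F. wf_fm (sig Dl) (farity (sig Dh) F) (map_fluent m F))"

primrec map_form :: "('n, 'fh, 'ah, 'fl, 'al) refmap \<Rightarrow> ('n, 'fh) fm \<Rightarrow> ('n, 'fl) fm" where
  "map_form m (Flu F ts) = subst_fm (params ts) (map_fluent m F)"
| "map_form m (Eq t u) = Eq t u"
| "map_form m TrueF = TrueF"
| "map_form m (Neg \<phi>) = Neg (map_form m \<phi>)"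
| "map_form m (Conj \<phi> \<psi>) = Conj (map_form m \<phi>) (map_form m \<psi>)"
| "map_form m (Exists \<phi>) = Exists (map_form m \<phi>)"

definition map_ground ::
  "('n, 'fh, 'ah, 'fl, 'al) refmap \<Rightarrow> 'ah \<times> 'n list \<Rightarrow> ('n, 'fl, 'al) prog" where
  "map_ground m = (\<lambda>(A, ns). subst_prog (params (map Cst ns)) (map_action m A))"

fun map_seq ::
  "('n, 'fh, 'ah, 'fl, 'al) refmap \<Rightarrow> ('ah \<times> 'n list) list \<Rightarrow> ('n, 'fl, 'al) prog" where
  "map_seq m [] = nil"
| "map_seq m [\<alpha>] = map_ground m \<alpha>"
| "map_seq m (\<alpha> # \<beta> # as) = Seq (map_ground m \<alpha>) (map_seq m (\<beta> # as))"

definition ground_action :: "('f, 'a) signat \<Rightarrow> 'a \<times> 'n list \<Rightarrow> bool" where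
  "ground_action sg = (\<lambda>(A, ns). length ns = aarity sg A)"

subsection \<open>Bisimulation\<close>

definition m_isomorphic ::
  "('fh, 'ah) signat \<Rightarrow> ('n, 'fh, 'ah, 'fl, 'al) refmap
     \<Rightarrow> ('n, 'fh, 'ah, 'dh, 'sh, 'y) sc_struct_scheme
     \<Rightarrow> ('n, 'fl, 'al, 'dl, 'sl, 'z) sc_struct_scheme \<Rightarrow> 'sh \<Rightarrow> 'sl \<Rightarrow> bool" where
  "m_isomorphic sg m Mh Ml sh sl \<longleftrightarrow>
     (\<forall>F v. sat Mh v sh (Flu F (xvars (farity sg F))) \<longleftrightarrow> sat Ml v sl (map_fluent m F))"

text \<open>\<open>hl_step sg M v A s s'\<close> is \<open>M, v \<Turnstile> Poss(A(x), s) \<and> s' = do(A(x), s)\<close>.\<close>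

definition hl_step ::
  "('f, 'a) signat \<Rightarrow> ('n, 'f, 'a, 'd, 's, 'z) sc_struct_scheme \<Rightarrow> (nat \<Rightarrow> 'n) \<Rightarrow> 'a
     \<Rightarrow> 's \<Rightarrow> 's \<Rightarrow> bool" where
  "hl_step sg M v A s s' \<longleftrightarrow>
     (let d = act M A (map (eval_tm v) (xvars (aarity sg A)))
      in Poss M d s \<and> s' = do_act M d s)"

definition m_bisimulation ::
  "('fh, 'ah) signat \<Rightarrow> ('n, 'fh, 'ah, 'fl, 'al) refmap
     \<Rightarrow> ('n, 'fh, 'ah, 'dh, 'sh, 'y) sc_struct_scheme
     \<Rightarrow> ('n, 'fl, 'al, 'dl, 'sl, 'z) cg_struct_scheme \<Rightarrow> ('sh \<times> 'sl) set \<Rightarrow> bool" where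
  "m_bisimulation sg m Mh Ml B \<longleftrightarrow>
     (\<forall>(sh, sl) \<in> B.
        m_isomorphic sg m Mh Ml sh sl \<and>
        (\<forall>A v sh'. hl_step sg Mh v A sh sh' \<longrightarrow>
           (\<exists>sl'. Do Ml (close_prog v (map_action m A)) sl sl' \<and> (sh', sl') \<in> B)) \<and>
        (\<forall>A v sl'. Do Ml (close_prog v (map_action m A)) sl sl' \<longrightarrow>
           (\<exists>sh'. hl_step sg Mh v A sh sh' \<and> (sh', sl') \<in> B)))"

definition m_bisimilar ::
  "('fh, 'ah) signat \<Rightarrow> ('n, 'fh, 'ah, 'fl, 'al) refmap
     \<Rightarrow> ('n, 'fh, 'ah, 'dh, 'sh, 'y) sc_struct_scheme
     \<Rightarrow> ('n, 'fl, 'al, 'dl, 'sl, 'z) cg_struct_scheme \<Rightarrow> bool" where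
  "m_bisimilar sg m Mh Ml \<longleftrightarrow> (\<exists>B. m_bisimulation sg m Mh Ml B \<and> (S0 Mh, S0 Ml) \<in> B)"

end

theory Submission
  imports Defs
begin

text \<open>
  Programs compose: \<open>Do(\<delta>\<^sub>1;\<delta>\<^sub>2, s, s')\<close> holds iff some \<open>s''\<close> satisfies \<open>Do(\<delta>\<^sub>1, s, s'')\<close> and
  \<open>Do(\<delta>\<^sub>2, s'', s')\<close>. Hence a terminating run of \<open>m(\<alpha>\<^sub>1);\<dots>;m(\<alpha>\<^sub>n)\<close> splits into runs of the
  \<open>m(\<alpha>\<^sub>i)\<close>, and the bisimulation matches each of them with a possible high-level action, and
  conversely. Both sides end in a bisimilar pair of situations, and bisimilar situations satisfy
  \<open>\<phi>\<close> and \<open>m(\<phi>)\<close> alike because they agree on the fluent atoms and quantifiers range over the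
  same standard names.
\<close>

subsection \<open>Substitution\<close>

lemma eval_subst_tm: "eval_tm v (subst_tm \<sigma> t) = eval_tm (\<lambda>i. eval_tm v (\<sigma> i)) t"
  by (cases t) auto

text \<open>Lifting a substitution under a binder keeps the new index 0 and shifts everything else
  past it, so it commutes with pushing a value \<open>n\<close> onto the assignment. This is the
  quantifier case of the substitution lemma that follows.\<close>

lemma eval_up: "(\<lambda>i. eval_tm (case_nat n v) (up \<sigma> i)) = case_nat n (\<lambda>i. eval_tm v (\<sigma> i))"
  by (rule ext) (simp add: up_def eval_subst_tm split: nat.split)

lemma sat_subst_fm: "sat M v s (subst_fm \<sigma> \<phi>) \<longleftrightarrow> sat M (\<lambda>i. eval_tm v (\<sigma> i)) s \<phi>"
  by (induction \<phi> arbitrary: v \<sigma>) (simp_all add: eval_subst_tm eval_up comp_def)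

lemma wf_subst_tm:
  assumes "wf_tm k t" and "\<And>i. i < k \<Longrightarrow> wf_tm j (\<sigma> i)"
  shows "wf_tm j (subst_tm \<sigma> t)"
  using assms by (cases t) auto

lemma wf_up:
  assumes "\<And>i. i < k \<Longrightarrow> wf_tm j (\<sigma> i)" and "i < Suc k"
  shows "wf_tm (Suc j) (up \<sigma> i)"
proof (cases i)
  case (Suc n)
  with assms have "wf_tm j (\<sigma> n)" by simp
  then have "wf_tm (Suc j) (subst_tm (\<lambda>j. Var (Suc j)) (\<sigma> n))"
    by (rule wf_subst_tm) simp
  then show ?thesis by (simp add: up_def Suc)
qed (simp add: up_def)

lemma wf_subst_fm:
  assumes "wf_fm sg k \<phi>" and "\<And>i. i < k \<Longrightarrow> wf_tm j (\<sigma> i)"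
  shows "wf_fm sg j (subst_fm \<sigma> \<phi>)"
  using assms
proof (induction \<phi> arbitrary: k j \<sigma>)
  case (Exists \<phi>)
  then have "wf_fm sg (Suc j) (subst_fm (up \<sigma>) \<phi>)"
    by (intro Exists.IH[of "Suc k"] wf_up) auto
  then show ?case by simp
qed (auto intro: wf_subst_tm)

lemma wf_subst_prog:
  assumes "wf_prog sg k \<delta>" and "\<And>i. i < k \<Longrightarrow> wf_tm j (\<sigma> i)"
  shows "wf_prog sg j (subst_prog \<sigma> \<delta>)"
  using assms
proof (induction \<delta> arbitrary: k j \<sigma>)
  case (Pick \<delta>)
  then have "wf_prog sg (Suc j) (subst_prog (up \<sigma>) \<delta>)"
    by (intro Pick.IH[of "Suc k"] wf_up) auto
  then show ?case by simp
qed (auto intro: wf_subst_tm wf_subst_fm)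

text \<open>For \<open>k = 0\<close> this keeps the instances of a pick body inside the program
  sort, where the axioms apply.\<close>

lemma wf_bind_name:
  assumes "wf_prog sg (Suc k) \<delta>"
  shows "wf_prog sg k (bind_name n \<delta>)"
  unfolding bind_name_def using assms
  by (rule wf_subst_prog) (simp split: nat.split)

lemma subst_tm_cong:
  assumes "wf_tm k t" and "\<And>i. i < k \<Longrightarrow> \<sigma> i = \<tau> i"
  shows "subst_tm \<sigma> t = subst_tm \<tau> t"
  using assms(1) by (cases t) (simp_all add: assms(2))

lemma up_cong:
  assumes "\<And>i. i < k \<Longrightarrow> \<sigma> i = \<tau> i" and "i < Suc k"
  shows "up \<sigma> i = up \<tau> i"
  using assms(2) by (cases i) (simp_all add: up_def assms(1))

lemma subst_fm_cong:
  assumes "wf_fm sg k \<phi>" and "\<And>i. i < k \<Longrightarrow> \<sigma> i = \<tau> i"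
  shows "subst_fm \<sigma> \<phi> = subst_fm \<tau> \<phi>"
  using assms
proof (induction \<phi> arbitrary: k \<sigma> \<tau>)
  case (Exists \<phi>)
  then have "subst_fm (up \<sigma>) \<phi> = subst_fm (up \<tau>) \<phi>"
    by (intro Exists.IH[of "Suc k"] up_cong) auto
  then show ?case by simp
next
  case (Conj \<phi> \<psi>)
  show ?case using Conj.IH[of k \<sigma> \<tau>] Conj.prems by simp
next
  case (Flu F ts)
  then show ?case using subst_tm_cong[of k _ \<sigma> \<tau>] by simp
next
  case (Eq t u)
  then show ?case using subst_tm_cong[of k _ \<sigma> \<tau>] by simp
next
  case (Neg \<phi>)
  show ?case using Neg.IH[of k \<sigma> \<tau>] Neg.prems by simp
qed simp

text \<open>Only indices below \<open>k\<close> occur free, so values of the substitution elsewhere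
  are irrelevant. This will identify two ways of instantiating \<open>map_action m A\<close> that
  differ beyond its parameters.\<close>

lemma subst_prog_cong:
  assumes "wf_prog sg k \<delta>" and "\<And>i. i < k \<Longrightarrow> \<sigma> i = \<tau> i"
  shows "subst_prog \<sigma> \<delta> = subst_prog \<tau> \<delta>"
  using assms
proof (induction \<delta> arbitrary: k \<sigma> \<tau>)
  case (Pick \<delta>)
  then have "subst_prog (up \<sigma>) \<delta> = subst_prog (up \<tau>) \<delta>"
    by (intro Pick.IH[of "Suc k"] up_cong) auto
  then show ?case by simp
next
  case (Seq \<delta>1 \<delta>2)
  show ?case using Seq.IH[of k \<sigma> \<tau>] Seq.prems by simp
next
  case (Choice \<delta>1 \<delta>2)
  show ?case using Choice.IH[of k \<sigma> \<tau>] Choice.prems by simp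
next
  case (Conc \<delta>1 \<delta>2)
  show ?case using Conc.IH[of k \<sigma> \<tau>] Conc.prems by simp
next
  case (Act A ts)
  then show ?case using subst_tm_cong[of k _ \<sigma> \<tau>] by simp
next
  case (Test \<phi>)
  then show ?case using subst_fm_cong[of sg k \<phi> \<sigma> \<tau>] by simp
next
  case (Star \<delta>)
  show ?case using Star.IH[of k \<sigma> \<tau>] Star.prems by simp
qed

text \<open>The axioms for primitive actions speak only of arguments of the form
  \<open>map Cst ns\<close>; a term without free indices must be a constant.\<close>

lemma closed_tms_eq_Cst:
  assumes "\<forall>t \<in> set ts. wf_tm 0 t"
  obtains ns where "ts = map Cst ns"
proof -
  have "\<exists>ns. ts = map Cst ns"
    using assms
  proof (induction ts)
    case (Cons t ts)
    then obtain ns where "ts = map Cst ns" by auto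
    moreover obtain n where "t = Cst n" using Cons.prems by (cases t) auto
    ultimately have "t # ts = map Cst (n # ns)" by simp
    then show ?case by (rule exI)
  qed simp
  with that show thesis by blast
qed

subsection \<open>Program execution\<close>

primrec depth :: "('n, 'f, 'a) prog \<Rightarrow> nat" where
  "depth (Act A ts) = 0"
| "depth (Test \<phi>) = 0"
| "depth (Seq \<delta>1 \<delta>2) = Suc (max (depth \<delta>1) (depth \<delta>2))"
| "depth (Choice \<delta>1 \<delta>2) = Suc (max (depth \<delta>1) (depth \<delta>2))"
| "depth (Pick \<delta>) = Suc (depth \<delta>)"
| "depth (Star \<delta>) = Suc (depth \<delta>)"
| "depth (Conc \<delta>1 \<delta>2) = Suc (max (depth \<delta>1) (depth \<delta>2))"

text \<open>Substitution rewrites only the terms and formulas at the leaves, which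
  \<open>depth\<close> counts as 0.\<close>

lemma depth_subst_prog [simp]: "depth (subst_prog \<sigma> \<delta>) = depth \<delta>"
  by (induction \<delta> arbitrary: \<sigma>) auto

lemma depth_bind_name [simp]: "depth (bind_name n \<delta>) = depth \<delta>"
  by (simp add: bind_name_def)

lemma wf_nil [simp]: "wf_prog sg k nil"
  by (simp add: nil_def)

section \<open>The ConGolog axioms on closed programs, and closure of the program sort under
  transitions\<close>

context
  fixes sg :: "('f, 'a) signat" and M :: "('n, 'f, 'a, 'd, 's, 'z) cg_struct_scheme"
  assumes cg: "congolog sg M"
begin

lemma Trans_Act:
  "wf_prog sg 0 (Act A (map Cst ns)) \<Longrightarrow> Trans M (Act A (map Cst ns)) s \<delta>' s' \<longleftrightarrow>
     s' = do_act M (act M A ns) s \<and> Poss M (act M A ns) s \<and> \<delta>' = nil"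
  using cg by (simp add: congolog_def)

lemma Trans_Test: "wf_prog sg 0 (Test \<phi>) \<Longrightarrow> \<not> Trans M (Test \<phi>) s \<delta>' s'"
  using cg by (simp add: congolog_def)

lemma Trans_Seq:
  "wf_prog sg 0 (Seq \<delta>1 \<delta>2) \<Longrightarrow> Trans M (Seq \<delta>1 \<delta>2) s \<delta>' s' \<longleftrightarrow>
     (\<exists>\<delta>1'. Trans M \<delta>1 s \<delta>1' s' \<and> \<delta>' = Seq \<delta>1' \<delta>2) \<or> (Final M \<delta>1 s \<and> Trans M \<delta>2 s \<delta>' s')"
  using cg by (simp add: congolog_def)

lemma Trans_Choice:
  "wf_prog sg 0 (Choice \<delta>1 \<delta>2) \<Longrightarrow>
     Trans M (Choice \<delta>1 \<delta>2) s \<delta>' s' \<longleftrightarrow> Trans M \<delta>1 s \<delta>' s' \<or> Trans M \<delta>2 s \<delta>' s'"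
  using cg by (simp add: congolog_def)

lemma Trans_Pick:
  "wf_prog sg 0 (Pick \<delta>) \<Longrightarrow>
     Trans M (Pick \<delta>) s \<delta>' s' \<longleftrightarrow> (\<exists>n. Trans M (bind_name n \<delta>) s \<delta>' s')"
  using cg by (simp add: congolog_def)

lemma Trans_Star:
  "wf_prog sg 0 (Star \<delta>) \<Longrightarrow>
     Trans M (Star \<delta>) s \<delta>' s' \<longleftrightarrow> (\<exists>\<delta>''. Trans M \<delta> s \<delta>'' s' \<and> \<delta>' = Seq \<delta>'' (Star \<delta>))"
  using cg by (simp add: congolog_def)

lemma Trans_Conc:
  "wf_prog sg 0 (Conc \<delta>1 \<delta>2) \<Longrightarrow> Trans M (Conc \<delta>1 \<delta>2) s \<delta>' s' \<longleftrightarrow>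
     (\<exists>\<delta>1'. Trans M \<delta>1 s \<delta>1' s' \<and> \<delta>' = Conc \<delta>1' \<delta>2) \<or>
     (\<exists>\<delta>2'. Trans M \<delta>2 s \<delta>2' s' \<and> \<delta>' = Conc \<delta>1 \<delta>2')"
  using cg by (simp add: congolog_def)

lemma Final_nil: "Final M nil s"
proof -
  have "wf_prog sg 0 (Test \<phi>) \<Longrightarrow> Final M (Test \<phi>) s \<longleftrightarrow> sat M v s \<phi>" for \<phi> v
    using cg by (simp add: congolog_def)
  from this[of TrueF] show ?thesis by (simp add: nil_def)
qed

lemma Final_Seq:
  "wf_prog sg 0 (Seq \<delta>1 \<delta>2) \<Longrightarrow> Final M (Seq \<delta>1 \<delta>2) s \<longleftrightarrow> Final M \<delta>1 s \<and> Final M \<delta>2 s"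
  using cg by (simp add: congolog_def)

text \<open>The instances \<open>\<delta>[n/x]\<close> in the axiom for \<open>\<pi>x.\<delta>\<close> are not subprograms, hence induction on the
  depth, which substitution preserves.\<close>

lemma wf_Trans:
  assumes "wf_prog sg 0 \<delta>" and "Trans M \<delta> s \<delta>' s'"
  shows "wf_prog sg 0 \<delta>'"
  using assms
proof (induction "depth \<delta>" arbitrary: \<delta> \<delta>' rule: less_induct)
  case less
  show ?case
  proof (cases \<delta>)
    case (Act A ts)
    with less.prems have "\<forall>t \<in> set ts. wf_tm 0 t" by simp
    then obtain ns where "ts = map Cst ns" by (rule closed_tms_eq_Cst)
    with Act less.prems show ?thesis by (simp add: Trans_Act)
  next
    case (Test \<phi>)
    with less.prems show ?thesis by (simp add: Trans_Test)
  next
    case (Seq \<delta>1 \<delta>2)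
    with less.prems(1) have wf: "wf_prog sg 0 \<delta>1" "wf_prog sg 0 \<delta>2" by simp_all
    have "depth \<delta>1 < depth \<delta>" "depth \<delta>2 < depth \<delta>" by (simp_all add: Seq)
    note IH = less.hyps[OF this(1) wf(1)] less.hyps[OF this(2) wf(2)]
    consider \<delta>1' where "Trans M \<delta>1 s \<delta>1' s'" "\<delta>' = Seq \<delta>1' \<delta>2" | "Trans M \<delta>2 s \<delta>' s'"
      using less.prems Trans_Seq unfolding Seq by blast
    then show ?thesis using IH wf by cases simp_all
  next
    case (Choice \<delta>1 \<delta>2)
    with less.prems(1) have wf: "wf_prog sg 0 \<delta>1" "wf_prog sg 0 \<delta>2" by simp_all
    have "depth \<delta>1 < depth \<delta>" "depth \<delta>2 < depth \<delta>" by (simp_all add: Choice)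
    note IH = less.hyps[OF this(1) wf(1)] less.hyps[OF this(2) wf(2)]
    have "Trans M \<delta>1 s \<delta>' s' \<or> Trans M \<delta>2 s \<delta>' s'"
      using less.prems Trans_Choice unfolding Choice by blast
    then show ?thesis using IH by blast
  next
    case (Pick \<delta>0)
    then obtain n where "Trans M (bind_name n \<delta>0) s \<delta>' s'"
      using less.prems Trans_Pick by blast
    moreover have "wf_prog sg 0 (bind_name n \<delta>0)"
      using less.prems(1) by (simp add: Pick wf_bind_name)
    moreover have "depth (bind_name n \<delta>0) < depth \<delta>" by (simp add: Pick)
    ultimately show ?thesis using less.hyps by blast
  next
    case (Star \<delta>0)
    with less.prems(1) have wf: "wf_prog sg 0 \<delta>0" by simp
    have "depth \<delta>0 < depth \<delta>" by (simp add: Star)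
    note IH = less.hyps[OF this wf]
    obtain \<delta>'' where "Trans M \<delta>0 s \<delta>'' s'" "\<delta>' = Seq \<delta>'' (Star \<delta>0)"
      using less.prems Trans_Star unfolding Star by blast
    then show ?thesis using IH wf by simp
  next
    case (Conc \<delta>1 \<delta>2)
    with less.prems(1) have wf: "wf_prog sg 0 \<delta>1" "wf_prog sg 0 \<delta>2" by simp_all
    have "depth \<delta>1 < depth \<delta>" "depth \<delta>2 < depth \<delta>" by (simp_all add: Conc)
    note IH = less.hyps[OF this(1) wf(1)] less.hyps[OF this(2) wf(2)]
    consider \<delta>1' where "Trans M \<delta>1 s \<delta>1' s'" "\<delta>' = Conc \<delta>1' \<delta>2"
      | \<delta>2' where "Trans M \<delta>2 s \<delta>2' s'" "\<delta>' = Conc \<delta>1 \<delta>2'"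
      using less.prems Trans_Conc unfolding Conc by blast
    then show ?thesis using IH wf by cases simp_all
  qed
qed

end

section \<open>Terminating runs and their composition\<close>

lemma Do_final: "Final M \<delta> s \<Longrightarrow> Do M \<delta> s s"
  unfolding Do_def TransStar_def by blast

lemma Do_step: "Trans M \<delta> s \<delta>' s' \<Longrightarrow> Do M \<delta>' s' s'' \<Longrightarrow> Do M \<delta> s s''"
  unfolding Do_def TransStar_def
  by (auto intro: converse_rtranclp_into_rtranclp)

text \<open>Induction along a terminating run from its first transition: the end situation stays
  fixed while the remaining program and the current situation vary.\<close>

lemma Do_induct [consumes 1, case_names final step]:
  assumes "Do M \<delta> s s'"
    and final: "\<And>\<delta>. Final M \<delta> s' \<Longrightarrow> P \<delta> s'"
    and step: "\<And>\<delta> s \<delta>1 s1. Trans M \<delta> s \<delta>1 s1 \<Longrightarrow> Do M \<delta>1 s1 s' \<Longrightarrow> P \<delta>1 s1 \<Longrightarrow> P \<delta> s"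
  shows "P \<delta> s"
proof -
  obtain \<delta>' where run: "(\<lambda>(\<delta>, s) (\<delta>', s'). Trans M \<delta> s \<delta>' s')\<^sup>*\<^sup>* (\<delta>, s) (\<delta>', s')"
    and fin: "Final M \<delta>' s'"
    using assms(1) unfolding Do_def TransStar_def by blast
  \<comment> \<open>\<open>Do\<close> is carried along in the induction because the premise
    \<open>step\<close> also demands that the remaining run terminates in \<open>s'\<close>.\<close>
  from run have "Do M \<delta> s s' \<and> P \<delta> s"
  proof (induction rule: converse_rtranclp_induct2)
    case refl
    show ?case by (intro conjI Do_final final fin)
  next
    case (step \<delta> s \<delta>1 s1)
    then have "Trans M \<delta> s \<delta>1 s1" and "Do M \<delta>1 s1 s'" and "P \<delta>1 s1" by simp_all
    then show ?case using Do_step assms(3) by (intro conjI) fast+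
  qed
  then show ?thesis ..
qed

lemma Do_cases [consumes 1, case_names final step]:
  assumes "Do M \<delta> s s'"
  obtains "s' = s" "Final M \<delta> s" | \<delta>1 s1 where "Trans M \<delta> s \<delta>1 s1" "Do M \<delta>1 s1 s'"
proof -
  have "s' = s \<and> Final M \<delta> s \<or> (\<exists>\<delta>1 s1. Trans M \<delta> s \<delta>1 s1 \<and> Do M \<delta>1 s1 s')"
    using assms by (induction rule: Do_induct) auto
  with that show thesis by blast
qed

text \<open>A test has no transitions, so the only run of \<open>nil\<close> is the empty one, and
  \<open>nil\<close> is final everywhere.\<close>

lemma Do_nil:
  assumes "congolog sg M"
  shows "Do M nil s s' \<longleftrightarrow> s' = s"
proof
  show "s' = s" if "Do M nil s s'"
    using that
  proof (cases rule: Do_cases)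
    case (step \<delta>1 s1)
    then show ?thesis using Trans_Test[OF assms, of TrueF] by (simp add: nil_def)
  qed
  show "Do M nil s s'" if "s' = s"
    using that by (simp add: Do_final Final_nil[OF assms])
qed

text \<open>A run of the sequence works inside \<open>\<delta>1\<close> until
  \<open>\<delta>1\<close> is final and \<open>\<delta>2\<close> takes over; the situation at the
  handover is the intermediate one. Since the axioms cover only closed well-formed programs,
  well-formedness has to be carried through every transition.\<close>

lemma Do_Seq:
  assumes cg: "congolog sg M" and wf: "wf_prog sg 0 \<delta>1" "wf_prog sg 0 \<delta>2"
  shows "Do M (Seq \<delta>1 \<delta>2) s s' \<longleftrightarrow> (\<exists>s''. Do M \<delta>1 s s'' \<and> Do M \<delta>2 s'' s')"
proof
  \<comment> \<open>The program is generalised to a variable tied to the sequence by an equation,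
    because each transition inside the first component changes that component;
    \<open>\<delta>2\<close> stays fixed.\<close>
  have "Do M \<delta> s s' \<Longrightarrow> \<delta> = Seq \<delta>1 \<delta>2 \<Longrightarrow> wf_prog sg 0 \<delta> \<Longrightarrow>
      \<exists>s''. Do M \<delta>1 s s'' \<and> Do M \<delta>2 s'' s'" for \<delta>
  proof (induction arbitrary: \<delta>1 rule: Do_induct)
    case (final \<delta>)
    then have "Final M \<delta>1 s'" "Final M \<delta>2 s'" using Final_Seq[OF cg] by simp_all
    then show ?case by (blast intro: Do_final)
  next
    case (step \<delta> s \<epsilon> s1)
    then consider \<delta>1' where "Trans M \<delta>1 s \<delta>1' s1" "\<epsilon> = Seq \<delta>1' \<delta>2"
      | "Final M \<delta>1 s" "Trans M \<delta>2 s \<epsilon> s1"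
      using Trans_Seq[OF cg] by blast
    then show ?case
    proof cases
      case 1
      have "wf_prog sg 0 \<epsilon>" using step.prems(2) step.hyps(1) by (rule wf_Trans[OF cg])
      with step.IH[OF 1(2)] obtain s'' where "Do M \<delta>1' s1 s''" "Do M \<delta>2 s'' s'" by blast
      with Do_step[OF 1(1)] show ?thesis by blast
    next
      \<comment> \<open>Handover: the run of \<open>\<delta>1\<close> is empty here, so
        \<open>s\<close> itself is the intermediate situation.\<close>
      case 2
      have "Do M \<delta>1 s s" "Do M \<delta>2 s s'"
        using Do_final[OF 2(1)] Do_step[OF 2(2) step.hyps(2)] by this
      then show ?thesis by blast
    qed
  qed
  then show "Do M (Seq \<delta>1 \<delta>2) s s' \<Longrightarrow> \<exists>s''. Do M \<delta>1 s s'' \<and> Do M \<delta>2 s'' s'"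
    using wf by simp
next
  assume "\<exists>s''. Do M \<delta>1 s s'' \<and> Do M \<delta>2 s'' s'"
  then obtain s'' where "Do M \<delta>1 s s''" and run2: "Do M \<delta>2 s'' s'" by blast
  then show "Do M (Seq \<delta>1 \<delta>2) s s'"
    using wf(1)
  proof (induction rule: Do_induct)
    case (final \<delta>)
    then have wfs: "wf_prog sg 0 (Seq \<delta> \<delta>2)" using wf(2) by simp
    \<comment> \<open>The first program is now final. Either the second one is final too, or its
      first transition is also a transition of the sequence by the handover disjunct of the
      axiom.\<close>
    from run2 show ?case
    proof (cases rule: Do_cases)
      case final
      then have "Final M (Seq \<delta> \<delta>2) s''" using \<open>Final M \<delta> s''\<close> Final_Seq[OF cg wfs] by simp
      then show ?thesis unfolding \<open>s' = s''\<close> by (rule Do_final)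
    next
      case (step \<epsilon> s1)
      then have "Trans M (Seq \<delta> \<delta>2) s'' \<epsilon> s1"
        using \<open>Final M \<delta> s''\<close> Trans_Seq[OF cg wfs] by simp
      then show ?thesis using step(2) by (rule Do_step)
    qed
  next
    case (step \<delta> s \<delta>' s1)
    then have "Do M (Seq \<delta>' \<delta>2) s1 s'" using wf_Trans[OF cg] by blast
    moreover have "Trans M (Seq \<delta> \<delta>2) s (Seq \<delta>' \<delta>2) s1"
      using step Trans_Seq[OF cg] wf(2) by simp
    ultimately show ?case by (rule Do_step[rotated])
  qed
qed

subsection \<open>Executability\<close>

lemma before_eq_do_act:
  assumes "foundational M"
  shows "before_eq M s (do_act M d s') \<longleftrightarrow> before_eq M s s' \<or> s = do_act M d s'"
  using assms by (simp add: foundational_def before_eq_def)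

lemma Executable_S0:
  assumes "foundational M"
  shows "Executable M (S0 M)"
proof -
  \<comment> \<open>The second fact shows that no \<open>do_act M d s\<close> equals
    \<open>S0 M\<close>: it has a predecessor, and \<open>S0 M\<close> has none.\<close>
  have "\<not> before M s (S0 M)" and "before M s (do_act M d s)" for d s
    using assms by (simp_all add: foundational_def before_eq_def)
  then show ?thesis unfolding Executable_def before_eq_def by metis
qed

text \<open>By injectivity of \<open>do_act\<close>, passing from \<open>s\<close> to
  \<open>do_act M d s\<close> adds a single requirement to the history, the one for \<open>d\<close>
  at \<open>s\<close>.\<close>

lemma Executable_do_act:
  assumes "foundational M"
  shows "Executable M (do_act M d s) \<longleftrightarrow> Executable M s \<and> Poss M d s"
proof -
  have "do_act M d1 s1 = do_act M d2 s2 \<longleftrightarrow> d1 = d2 \<and> s1 = s2" for d1 d2 s1 s2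
    using assms unfolding foundational_def by auto
  then have "before_eq M (do_act M d' s') (do_act M d s) \<longleftrightarrow>
      before_eq M (do_act M d' s') s \<or> d' = d \<and> s' = s" for d' s'
    by (simp add: before_eq_do_act[OF assms])
  then show ?thesis unfolding Executable_def by auto
qed

lemma do_seq_Nil [simp]: "do_seq M [] s = s"
  by (simp add: do_seq_def)

lemma do_seq_Cons [simp]: "do_seq M ((A, ns) # as) s = do_seq M as (do_act M (act M A ns) s)"
  by (simp add: do_seq_def)

lemma Executable_do_seqD:
  assumes "foundational M" and "Executable M (do_seq M as s)"
  shows "Executable M s"
  using assms(2)
  by (induction as arbitrary: s) (force simp: Executable_do_act[OF assms(1)])+

subsection \<open>Refinement\<close>

lemma sat_map_form:
  assumes "m_isomorphic sg m Mh Ml sh sl" and "wf_fm sg k \<phi>"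
  shows "sat Ml v sl (map_form m \<phi>) \<longleftrightarrow> sat Mh v sh \<phi>"
  using assms(2)
proof (induction \<phi> arbitrary: v k)
  case (Flu F ts)
  then have len: "length ts = farity sg F" by simp
  \<comment> \<open>\<open>?v\<close> gives parameter \<open>i\<close> the value of the argument
    \<open>ts ! i\<close>. As m-isomorphism holds under every assignment, it can be used at
    \<open>?v\<close>, which is where the substitution lemma moves
    \<open>map_fluent m F\<close>.\<close>
  let ?v = "\<lambda>i. eval_tm v (params ts i)"
  have "map (eval_tm ?v) (xvars (farity sg F)) = map (eval_tm v) ts"
    by (rule nth_equalityI) (simp_all add: xvars_def params_def len)
  moreover have "sat Mh ?v sh (Flu F (xvars (farity sg F))) \<longleftrightarrow> sat Ml ?v sl (map_fluent m F)"
    using assms(1) unfolding m_isomorphic_def by blast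
  ultimately show ?case by (simp add: sat_subst_fm)
qed auto

text \<open>Action sequences instantiate parameters by names, whereas bisimulations close schemas by
  assignments. The two agree since all free indices lie below \<open>length ns\<close>, where
  \<open>ns ! i\<close> is a genuine entry.\<close>

lemma map_ground_eq_close_prog:
  assumes "wf_prog sg (length ns) (map_action m A)"
  shows "map_ground m (A, ns) = close_prog (\<lambda>i. ns ! i) (map_action m A)"
  unfolding map_ground_def close_prog_def prod.case
  using assms by (rule subst_prog_cong) (simp add: params_def)

lemma wf_map_ground:
  assumes "wf_prog sg (length ns) (map_action m A)"
  shows "wf_prog sg 0 (map_ground m (A, ns))"
  unfolding map_ground_def prod.case
  using assms by (rule wf_subst_prog) (simp add: params_def)

lemma hl_step_nth:
  assumes "length ns = aarity sg A"
  shows "hl_step sg M (\<lambda>i. ns ! i) A s s' \<longleftrightarrow>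
    Poss M (act M A ns) s \<and> s' = do_act M (act M A ns) s"
proof -
  have "map (eval_tm (\<lambda>i. ns ! i)) (xvars (aarity sg A)) = ns"
    by (rule nth_equalityI) (simp_all add: xvars_def assms)
  then show ?thesis by (simp add: hl_step_def Let_def)
qed

section \<open>Matching action sequences along a bisimulation\<close>

context
  fixes sgh :: "('fh, 'ah) signat" and sgl :: "('fl, 'al) signat"
    and m :: "('n, 'fh, 'ah, 'fl, 'al) refmap"
    and Mh :: "('n, 'fh, 'ah, 'dh, 'sh, 'y) sc_struct_scheme"
    and Ml :: "('n, 'fl, 'al, 'dl, 'sl, 'z) cg_struct_scheme"
    and B :: "('sh \<times> 'sl) set"
  assumes found: "foundational Mh"
    and cg: "congolog sgl Ml"
    and wf: "\<And>A. wf_prog sgl (aarity sgh A) (map_action m A)"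
    and bisim: "m_bisimulation sgh m Mh Ml B"
begin

lemma wf_map_seq:
  "\<forall>\<alpha> \<in> set as. ground_action sgh \<alpha> \<Longrightarrow> wf_prog sgl 0 (map_seq m as)"
proof (induction as)
  case (Cons \<alpha> as)
  obtain A ns where \<alpha>: "\<alpha> = (A, ns)" by (cases \<alpha>)
  then have "wf_prog sgl (length ns) (map_action m A)"
    using Cons.prems wf[of A] by (simp add: ground_action_def)
  then have "wf_prog sgl 0 (map_ground m \<alpha>)" unfolding \<alpha> by (rule wf_map_ground)
  then show ?case using Cons by (cases as) auto
qed simp

lemma Do_map_seq_Cons:
  assumes "\<forall>\<alpha> \<in> set ((A, ns) # as). ground_action sgh \<alpha>"
  shows "Do Ml (map_seq m ((A, ns) # as)) s s' \<longleftrightarrow>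
    (\<exists>s''. Do Ml (close_prog (\<lambda>i. ns ! i) (map_action m A)) s s'' \<and> Do Ml (map_seq m as) s'' s')"
proof -
  have wfA: "wf_prog sgl (length ns) (map_action m A)"
    using assms wf[of A] by (simp add: ground_action_def)
  have "Do Ml (map_seq m ((A, ns) # as)) s s' \<longleftrightarrow>
    (\<exists>s''. Do Ml (map_ground m (A, ns)) s s'' \<and> Do Ml (map_seq m as) s'' s')"
  proof (cases as)
    \<comment> \<open>\<open>map_seq\<close> adds no trailing \<open>nil\<close> to a single action,
      so the empty tail contributes a stationary run and the intermediate situation is
      \<open>s'\<close>.\<close>
    case Nil
    then show ?thesis by (simp add: Do_nil[OF cg])
  next
    case (Cons \<beta> bs)
    then show ?thesis
      using Do_Seq[OF cg wf_map_ground[OF wfA] wf_map_seq[of as]] assms by simp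
  qed
  then show ?thesis using map_ground_eq_close_prog[OF wfA] by simp
qed

text \<open>Executability of the whole history makes the first action possible at \<open>sh\<close>;
  the forth condition of the bisimulation supplies a matching low-level run, and the induction
  continues from the pair reached.\<close>

lemma bisim_forth:
  assumes "(sh, sl) \<in> B" and "\<forall>\<alpha> \<in> set as. ground_action sgh \<alpha>"
    and "Executable Mh (do_seq Mh as sh)"
  shows "\<exists>sl'. Do Ml (map_seq m as) sl sl' \<and> (do_seq Mh as sh, sl') \<in> B"
  using assms
proof (induction as arbitrary: sh sl)
  case Nil
  then show ?case by (auto simp: Do_nil[OF cg])
next
  case (Cons \<alpha> as)
  obtain A ns where \<alpha>: "\<alpha> = (A, ns)" by (cases \<alpha>)
  then have len: "length ns = aarity sgh A" using Cons.prems by (simp add: ground_action_def)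
  let ?sh = "do_act Mh (act Mh A ns) sh"
  have ex: "Executable Mh (do_seq Mh as ?sh)" using Cons.prems \<alpha> by simp
  then have "Executable Mh ?sh" by (rule Executable_do_seqD[OF found])
  then have "hl_step sgh Mh (\<lambda>i. ns ! i) A sh ?sh"
    by (simp add: Executable_do_act[OF found] hl_step_nth[OF len])
  then obtain sl1 where "Do Ml (close_prog (\<lambda>i. ns ! i) (map_action m A)) sl sl1"
    and "(?sh, sl1) \<in> B"
    using bspec[OF bisim[unfolded m_bisimulation_def] Cons.prems(1)] by blast
  then show ?case
    using Cons.IH[of ?sh sl1] Cons.prems ex Do_map_seq_Cons[of A ns as] unfolding \<alpha> by auto
qed

text \<open>The low-level run is cut after the first action. The back condition shows that this
  action is possible at the high level, which extends executability by one step.\<close>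

lemma bisim_back:
  assumes "(sh, sl) \<in> B" and "\<forall>\<alpha> \<in> set as. ground_action sgh \<alpha>"
    and "Executable Mh sh" and "Do Ml (map_seq m as) sl sl'"
  shows "Executable Mh (do_seq Mh as sh) \<and> (do_seq Mh as sh, sl') \<in> B"
  using assms
proof (induction as arbitrary: sh sl)
  case Nil
  then show ?case by (simp add: Do_nil[OF cg])
next
  case (Cons \<alpha> as)
  obtain A ns where \<alpha>: "\<alpha> = (A, ns)" by (cases \<alpha>)
  then have len: "length ns = aarity sgh A" using Cons.prems by (simp add: ground_action_def)
  let ?sh = "do_act Mh (act Mh A ns) sh"
  obtain sl1 where "Do Ml (close_prog (\<lambda>i. ns ! i) (map_action m A)) sl sl1"
    and run: "Do Ml (map_seq m as) sl1 sl'"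
    using Cons.prems Do_map_seq_Cons[of A ns as] unfolding \<alpha> by blast
  then obtain sh1 where "hl_step sgh Mh (\<lambda>i. ns ! i) A sh sh1" and "(sh1, sl1) \<in> B"
    using bspec[OF bisim[unfolded m_bisimulation_def] Cons.prems(1)] by blast
  \<comment> \<open>High-level actions are deterministic, so the partner \<open>sh1\<close> can only
    be \<open>?sh\<close>.\<close>
  then have "Poss Mh (act Mh A ns) sh" and "(?sh, sl1) \<in> B"
    by (simp_all add: hl_step_nth[OF len])
  then show ?case
    using Cons.IH[of ?sh sl1] Cons.prems run Executable_do_act[OF found] unfolding \<alpha> by simp
qed

end

theorem theorem1:
  fixes Dh :: "('n::{countable, infinite}, 'fh::finite, 'ah::finite) bat"
    and Dl :: "('n, 'fl::finite, 'al::finite) bat"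
    and Mh :: "('n, 'fh, 'ah, 'dh, 'sh) sc_struct"
    and Ml :: "('n, 'fl, 'al, 'dl, 'sl) cg_struct"
    and m :: "('n, 'fh, 'ah, 'fl, 'al) refmap"
    and as :: "('ah \<times> 'n list) list"
    and \<phi> :: "('n, 'fh) fm"
    and k :: nat
    and v :: "nat \<Rightarrow> 'n"
  assumes "is_bat Dh" and "is_bat Dl"
    and "models_bat Mh Dh"
    and "models_bat Ml Dl" and "congolog (sig Dl) Ml"
    and "refinement_mapping TYPE('dl \<times> 'sl) Dh Dl m"
    and "m_bisimilar (sig Dh) m Mh Ml"
    and "\<forall>\<alpha> \<in> set as. ground_action (sig Dh) \<alpha>"
    and "wf_fm (sig Dh) k \<phi>"
  shows "(\<exists>s'. Do Ml (map_seq m as) (S0 Ml) s' \<and> sat Ml v s' (map_form m \<phi>)) \<longleftrightarrow>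
         Executable Mh (do_seq Mh as (S0 Mh)) \<and> sat Mh v (do_seq Mh as (S0 Mh)) \<phi>"
proof -
  obtain B where B: "m_bisimulation (sig Dh) m Mh Ml B" "(S0 Mh, S0 Ml) \<in> B"
    using assms(7) unfolding m_bisimilar_def by blast
  have found: "foundational Mh"
    using assms(3) by (simp add: models_bat_def)
  have wf: "wf_prog (sig Dl) (aarity (sig Dh) A) (map_action m A)" for A
    using assms(6) by (simp add: refinement_mapping_def)
  have agree: "sat Ml v sl (map_form m \<phi>) \<longleftrightarrow> sat Mh v sh \<phi>" if "(sh, sl) \<in> B" for sh sl
  proof -
    have "m_isomorphic (sig Dh) m Mh Ml sh sl"
      using bspec[OF B(1)[unfolded m_bisimulation_def] that] by simp
    then show ?thesis using assms(9) by (rule sat_map_form)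
  qed
  show ?thesis (is "?low \<longleftrightarrow> ?high")
  proof
    assume ?low
    then obtain sl where run: "Do Ml (map_seq m as) (S0 Ml) sl" and "sat Ml v sl (map_form m \<phi>)"
      by blast
    moreover have "Executable Mh (do_seq Mh as (S0 Mh)) \<and> (do_seq Mh as (S0 Mh), sl) \<in> B"
      by (rule bisim_back[OF found assms(5) wf B assms(8) Executable_S0[OF found] run])
    ultimately show ?high using agree by fast
  next
    assume ?high
    then have ex: "Executable Mh (do_seq Mh as (S0 Mh))" and sat: "sat Mh v (do_seq Mh as (S0 Mh)) \<phi>"
      by simp_all
    obtain sl where "Do Ml (map_seq m as) (S0 Ml) sl" and pair: "(do_seq Mh as (S0 Mh), sl) \<in> B"
      using bisim_forth[OF found assms(5) wf B assms(8) ex] by (elim exE conjE)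
    moreover have "sat Ml v sl (map_form m \<phi>)" using sat agree[OF pair] by simp
    ultimately show ?low by (intro exI conjI)
  qed
qed

end
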